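(* Let $g:\mathbb{R}^d\to\overline{\mathbb{R}}$ be proper, convex and lower semicontinuous, and let $f:\mathbb{R}^d\to\mathbb{R}$ be a differentiable convex function whose gradient is Lipschitz continuous with constant $L>0$. Let $x_0\in\mathbb{R}^d$, let $\{\alpha_k\}_{k\in\mathbb{N}}\subseteq(0,1/L)$, and define $$x_{k+1}=\operatorname{prox}_{\alpha_k g}\big(x_k-\alpha_k\nabla f(x_k)\big),\qquad \forall k\ge 0.$$ Then the sequence $\{x_k\}_{k\ge 0}$ is self-contracted.
   Context: $\mathbb{R}^d$ is the $d$-dimensional Euclidean space with norm $\|\cdot\|$, and $\overline{\mathbb{R}}$ denotes the extended reals. For $\alpha>0$ and $g$ proper, convex and lower semicontinuous, $\operatorname{prox}_{\alpha g}(x)$ is the unique minimizer over $z\in\mathbb{R}^d$ of $g(z)+\frac{1}{2\alpha}\|z-x\|^2$. A sequence $\{x_k\}_{k\in\mathbb{N}}$ in $\mathbb{R}^d$ is called self-contracted if for all indices $k_1\le k_2\le k_3$ one has $\|x_{k_3}-x_{k_2}\|\le\|x_{k_3}-x_{k_1}\|$. *)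

theory Defs
  imports "HOL-Analysis.Analysis"
begin

definition proper_fun :: "('a \<Rightarrow> ereal) \<Rightarrow> bool" where
  "proper_fun g \<longleftrightarrow> (\<forall>x. g x \<noteq> -\<infinity>) \<and> (\<exists>x. g x \<noteq> \<infinity>)"

text \<open>
  The library's \<^const>\<open>convex_on\<close> is restricted to real-valued functions.
  In \<^typ>\<open>ereal\<close> one has \<^prop>\<open>0 * \<infinity> = (0::ereal)\<close>, so the endpoints
  \<open>u = 0\<close> and \<open>v = 0\<close> of the inequality below are harmless also where \<open>g\<close> is infinite.
\<close>

definition convex_ereal_fun :: "('a::real_vector \<Rightarrow> ereal) \<Rightarrow> bool" where
  "convex_ereal_fun g \<longleftrightarrow>
     (\<forall>x y. \<forall>u\<ge>0. \<forall>v\<ge>0. u + v = 1 \<longrightarrow>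
        g (u *\<^sub>R x + v *\<^sub>R y) \<le> ereal u * g x + ereal v * g y)"

definition lower_semicontinuous :: "('a::topological_space \<Rightarrow> ereal) \<Rightarrow> bool" where
  "lower_semicontinuous g \<longleftrightarrow> (\<forall>x. g x \<le> Liminf (at x) g)"

text \<open>
  The definite description yields the minimizer only where it exists and is unique, as is the
  case for proper, convex and lower semicontinuous \<open>g\<close> and positive \<open>\<alpha>\<close>; otherwise the value
  is unspecified.
\<close>

definition prox :: "real \<Rightarrow> ('a::euclidean_space \<Rightarrow> ereal) \<Rightarrow> 'a \<Rightarrow> 'a" where
  "prox \<alpha> g x =
     (THE z. is_arg_min (\<lambda>z. g z + ereal (1 / (2 * \<alpha>) * (norm (z - x))\<^sup>2)) (\<lambda>_. True) z)"

definition self_contracted :: "(nat \<Rightarrow> 'a::real_normed_vector) \<Rightarrow> bool" where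
  "self_contracted x \<longleftrightarrow>
     (\<forall>k1 k2 k3. k1 \<le> k2 \<and> k2 \<le> k3 \<longrightarrow> norm (x k3 - x k2) \<le> norm (x k3 - x k1))"

end

theory Submission
  imports Defs
begin

text \<open>
  Write \<open>F = f + g\<close>. Optimality of the proximal step, the tangent inequality for \<open>f\<close> and the descent
  lemma together give
  \<open>2 \<alpha>\<^sub>k (F x\<^sub>k\<^sub>+\<^sub>1 - F z) \<le> \<parallel>z - x\<^sub>k\<parallel>\<^sup>2 - \<parallel>z - x\<^sub>k\<^sub>+\<^sub>1\<parallel>\<^sup>2\<close> for every \<open>z\<close> in the domain of \<open>g\<close>.
  Taking \<open>z = x\<^sub>k\<close> with \<open>k \<ge> 1\<close> (\<open>g x\<^sub>0\<close> may be infinite) shows that \<open>F\<close> decreases from \<open>x\<^sub>1\<close> on, so \<open>z = x\<^sub>m\<close> with \<open>m > k\<close> makes the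
  left-hand side nonnegative: each step of the iteration moves closer to every later iterate.
\<close>

section \<open>Lower semicontinuity and attainment of the minimum\<close>

lemma lower_semicontinuousD:
  assumes "lower_semicontinuous g" "y < g x"
  shows "\<forall>\<^sub>F z in nhds x. y < g z"
  using assms
  by (auto simp: lower_semicontinuous_def le_Liminf_iff eventually_at_filter elim!: eventually_mono)

lemma lower_semicontinuous_add_continuous:
  fixes h :: "'a::topological_space \<Rightarrow> real"
  assumes "lower_semicontinuous g" "continuous_on UNIV h"
  shows "lower_semicontinuous (\<lambda>z. g z + ereal (h z))"
  unfolding lower_semicontinuous_def le_Liminf_iff
proof (intro allI impI)
  fix x y assume "y < g x + ereal (h x)"
  then have "y - ereal (h x) < g x"
    by (simp add: ereal_minus_less)
  \<comment> \<open>The real \<open>s\<close> splits the gap: near \<open>x\<close>, lower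
    semicontinuity keeps \<open>g z\<close> above \<open>s\<close>, and continuity of
    \<open>h\<close> keeps \<open>s + h z\<close> above \<open>y\<close>.\<close>
  then obtain s where s: "y - ereal (h x) < ereal s" "ereal s < g x"
    using ereal_dense2 by blast
  have "(h \<longlongrightarrow> h x) (at x)"
    using assms(2) by (simp add: continuous_on_def)
  then have "((\<lambda>z. ereal (s + h z)) \<longlongrightarrow> ereal (s + h x)) (at x)"
    by (intro tendsto_intros)
  moreover have "y < ereal (s + h x)"
    using s(1) by (simp add: ereal_minus_less)
  ultimately have "\<forall>\<^sub>F z in at x. y < ereal (s + h z)"
    by (rule order_tendstoD)
  moreover have "\<forall>\<^sub>F z in at x. ereal s < g z"
    using lower_semicontinuousD[of g, OF assms(1) s(2)] by (auto simp: eventually_at_filter elim: eventually_mono)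
  ultimately show "\<forall>\<^sub>F z in at x. y < g z + ereal (h z)"
  proof eventually_elim
    case (elim z)
    have "ereal (s + h z) \<le> g z + ereal (h z)"
      using add_right_mono[OF less_imp_le[OF elim(2)], of "ereal (h z)"] by simp
    with elim(1) show ?case by (rule less_le_trans)
  qed
qed

lemma closed_sublevel_lower_semicontinuous:
  assumes "lower_semicontinuous g"
  shows "closed {z. g z \<le> c}"
proof -
  have "open {z. c < g z}"
    unfolding open_subopen[of "{z. c < g z}"]
    using lower_semicontinuousD[of g, OF assms] by (fastforce simp: eventually_nhds)
  then show ?thesis
    by (simp add: closed_def Collect_neg_eq[symmetric] not_le)
qed

text \<open>Weierstrass without minimizing sequences: the sublevel sets at attained levels up to
  \<open>\<phi> a\<close> form a chain of nonempty compact sets, so they share a point. It minimizes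
  on the sublevel set of \<open>a\<close>, and outside of it the values exceed
  \<open>\<phi> a\<close>.\<close>

lemma lower_semicontinuous_attains_inf:
  fixes \<phi> :: "'a::heine_borel \<Rightarrow> ereal"
  assumes lsc: "lower_semicontinuous \<phi>" and bdd: "bounded {z. \<phi> z \<le> \<phi> a}"
  shows "\<exists>p. \<forall>z. \<phi> p \<le> \<phi> z"
proof -
  let ?C = "(\<lambda>y. {z. \<phi> z \<le> \<phi> y}) ` {y. \<phi> y \<le> \<phi> a}"
  have "\<Inter> ?C \<noteq> {}"
  proof (rule compact_chain)
    fix S assume "S \<in> ?C"
    then obtain y where y: "S = {z. \<phi> z \<le> \<phi> y}" "\<phi> y \<le> \<phi> a" by auto
    then have "bounded S"
      by (intro bounded_subset[OF bdd]) auto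
    with y(1) show "compact S"
      by (simp add: compact_eq_bounded_closed closed_sublevel_lower_semicontinuous lsc)
  next
    fix S T assume "S \<in> ?C \<and> T \<in> ?C"
    then obtain y z where "S = {w. \<phi> w \<le> \<phi> y}" "T = {w. \<phi> w \<le> \<phi> z}" by auto
    then show "S \<subseteq> T \<or> T \<subseteq> S"
      by (cases "\<phi> y \<le> \<phi> z") (auto intro: order_trans)
  qed auto
  then obtain p where p: "\<And>y. \<phi> y \<le> \<phi> a \<Longrightarrow> \<phi> p \<le> \<phi> y"
    by auto
  then have "\<phi> p \<le> \<phi> z" for z
    using order_trans[OF p[OF order_refl], of "\<phi> z"] p[of z] by (cases "\<phi> z \<le> \<phi> a") auto
  then show ?thesis by blast
qed

section \<open>Convex functions along segments and their growth from below\<close>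

lemma convex_ereal_fun_segment:
  assumes "convex_ereal_fun g" "g x = ereal a" "g y = ereal b" "0 \<le> t" "t \<le> 1"
  shows "g (x + t *\<^sub>R (y - x)) \<le> ereal ((1 - t) * a + t * b)"
proof -
  have "g ((1 - t) *\<^sub>R x + t *\<^sub>R y) \<le> ereal (1 - t) * g x + ereal t * g y"
    using assms(4,5) by (intro assms(1)[unfolded convex_ereal_fun_def, rule_format]) auto
  moreover have "(1 - t) *\<^sub>R x + t *\<^sub>R y = x + t *\<^sub>R (y - x)"
    by (simp add: algebra_simps)
  ultimately show ?thesis using assms by simp
qed

text \<open>Replaces an affine minorant in the coercivity argument. Lower semicontinuity bounds
  \<open>g\<close> below on a ball around \<open>x\<close>; a value far below this linear bound at a
  distant point would, by convexity, pull \<open>g\<close> too low inside the ball.\<close>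

lemma convex_ereal_fun_lower_bound:
  fixes g :: "'a::real_normed_vector \<Rightarrow> ereal"
  assumes cvx: "convex_ereal_fun g" and lsc: "lower_semicontinuous g" and a: "g x = ereal a"
  shows "\<exists>K. \<forall>z. ereal (a - 1 - K * norm (z - x)) \<le> g z"
proof -
  have "\<forall>\<^sub>F z in nhds x. ereal (a - 1) < g z"
    using lsc a by (intro lower_semicontinuousD) auto
  then obtain \<delta> where \<delta>: "\<delta> > 0" "\<And>z. dist z x < \<delta> \<Longrightarrow> ereal (a - 1) < g z"
    by (auto simp: eventually_nhds_metric)
  have "ereal (a - 1 - 2 / \<delta> * norm (z - x)) \<le> g z" for z
  proof (cases "dist z x < \<delta>")
    case True
    have "ereal (a - 1 - 2 / \<delta> * norm (z - x)) \<le> ereal (a - 1)"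
      using \<delta>(1) by simp
    then show ?thesis using \<delta>(2)[OF True] by (meson less_imp_le order_trans)
  next
    case False
    \<comment> \<open>This puts the point \<open>x + t *\<^sub>R (z - x)\<close> at distance
      \<open>\<delta> / 2\<close> from \<open>x\<close>, hence inside the ball.\<close>
    define t where "t = \<delta> / (2 * norm (z - x))"
    from False \<delta>(1) have pos: "norm (z - x) > 0" and le: "\<delta> \<le> norm (z - x)"
      by (auto simp: dist_norm)
    have t: "0 < t" "t \<le> 1" "1 / t = 2 / \<delta> * norm (z - x)"
      using pos le \<delta>(1) by (auto simp: t_def field_simps)
    have "dist (x + t *\<^sub>R (z - x)) x < \<delta>"
      using pos \<delta>(1) t(1) by (simp add: dist_norm) (simp add: t_def)
    then have low: "ereal (a - 1) < g (x + t *\<^sub>R (z - x))" by (rule \<delta>(2))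
    \<comment> \<open>Testing against every real upper bound \<open>b\<close> of \<open>g z\<close>
      covers infinite values of \<open>g z\<close> without a case distinction.\<close>
    have key: "a - 1 - 1 / t \<le> b" if "g z \<le> ereal b" for b
    proof -
      have "x + t *\<^sub>R (z - x) = (1 - t) *\<^sub>R x + t *\<^sub>R z"
        by (simp add: algebra_simps)
      moreover have "g ((1 - t) *\<^sub>R x + t *\<^sub>R z) \<le> ereal (1 - t) * g x + ereal t * g z"
        using t by (intro cvx[unfolded convex_ereal_fun_def, rule_format]) auto
      ultimately have "g (x + t *\<^sub>R (z - x)) \<le> ereal (1 - t) * g x + ereal t * g z"
        by simp
      also have "\<dots> \<le> ereal (1 - t) * ereal a + ereal t * ereal b"
        using a that t by (intro add_mono ereal_mult_left_mono) auto
      finally have "a - 1 < (1 - t) * a + t * b"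
        using less_le_trans[OF low] by fastforce
      then have "t * (a - b) < 1" by (simp add: algebra_simps)
      then have "a - b < 1 / t" using t by (simp add: field_simps)
      then show ?thesis by simp
    qed
    show ?thesis
      unfolding t(3)[symmetric] by (rule ereal_le_real) (use key in auto)
  qed
  then show ?thesis by blast
qed

section \<open>The proximal map: variational inequality, existence and uniqueness\<close>

lemma prox_objective_minimizer_inequality:
  fixes g :: "'a::real_inner \<Rightarrow> ereal"
  assumes cvx: "convex_ereal_fun g" and "c > 0"
    and min: "\<And>z. g p + ereal (c * (norm (p - w))\<^sup>2) \<le> g z + ereal (c * (norm (z - w))\<^sup>2)"
    and p: "g p = ereal a" and z: "g z = ereal b"
  shows "a - b \<le> 2 * c * ((p - w) \<bullet> (z - p))"
proof -
  let ?i = "(p - w) \<bullet> (z - p)" and ?n = "(norm (z - p))\<^sup>2"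
  \<comment> \<open>Compare \<open>p\<close> with the point at fraction \<open>t\<close> of the
    segment to \<open>z\<close>. After expanding the square and cancelling one factor
    \<open>t\<close>, the only remainder is linear in \<open>t\<close> and vanishes as
    \<open>t\<close> tends to 0.\<close>
  have *: "a - b \<le> 2 * c * ?i + t * (c * ?n)" if "0 < t" "t \<le> 1" for t
  proof -
    have "ereal (a + c * (norm (p - w))\<^sup>2)
        \<le> g (p + t *\<^sub>R (z - p)) + ereal (c * (norm (p + t *\<^sub>R (z - p) - w))\<^sup>2)"
      using min[of "p + t *\<^sub>R (z - p)"] p by simp
    also have "\<dots> \<le> ereal ((1 - t) * a + t * b) + ereal (c * (norm (p + t *\<^sub>R (z - p) - w))\<^sup>2)"
      using that by (intro add_right_mono convex_ereal_fun_segment[OF cvx p z]) auto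
    finally have "a + c * (norm (p - w))\<^sup>2
        \<le> (1 - t) * a + t * b + c * (norm (p + t *\<^sub>R (z - p) - w))\<^sup>2"
      by simp
    also have "p + t *\<^sub>R (z - p) - w = (p - w) + t *\<^sub>R (z - p)"
      by simp
    also have "(norm \<dots>)\<^sup>2 = (norm (p - w))\<^sup>2 + 2 * t * ?i + t\<^sup>2 * ?n"
      unfolding power2_norm_eq_inner inner_add_left inner_add_right
      by (simp add: inner_commute[of "z - p" "p - w"] power2_eq_square)
    finally have "t * (a - b) \<le> t * (2 * c * ?i + t * (c * ?n))"
      by (simp add: algebra_simps power2_eq_square)
    then show ?thesis using that by simp
  qed
  have "((\<lambda>t. 2 * c * ?i + t * (c * ?n)) \<longlongrightarrow> 2 * c * ?i + 0 * (c * ?n)) (at_right 0)"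
    by (intro tendsto_intros)
  moreover have "\<forall>\<^sub>F t in at_right 0. a - b \<le> 2 * c * ?i + t * (c * ?n)"
    using eventually_at_right_real[OF zero_less_one] by eventually_elim (rule *, simp_all)
  ultimately have "a - b \<le> 2 * c * ?i + 0 * (c * ?n)"
    by (rule tendsto_lowerbound) simp
  then show ?thesis by simp
qed

text \<open>The quadratic term outgrows the at most linear decay of \<open>g\<close>, so a sublevel
  set of the objective is bounded and the minimum is attained.\<close>

lemma prox_objective_has_minimizer:
  fixes g :: "'a::euclidean_space \<Rightarrow> ereal"
  assumes "proper_fun g" and cvx: "convex_ereal_fun g" and lsc: "lower_semicontinuous g" and "c > 0"
  shows "\<exists>p. \<forall>z. g p + ereal (c * (norm (p - w))\<^sup>2) \<le> g z + ereal (c * (norm (z - w))\<^sup>2)"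
proof -
  obtain x a where a: "g x = ereal a"
    using assms(1) unfolding proper_fun_def by (metis ereal_cases)
  obtain K where K: "\<And>z. ereal (a - 1 - K * norm (z - x)) \<le> g z"
    using convex_ereal_fun_lower_bound[OF cvx lsc a] by blast
  let ?\<phi> = "\<lambda>z. g z + ereal (c * (norm (z - w))\<^sup>2)"
  have "lower_semicontinuous ?\<phi>"
    by (intro lower_semicontinuous_add_continuous lsc continuous_intros)
  moreover have "bounded {z. ?\<phi> z \<le> ?\<phi> x}"
  proof -
    \<comment> \<open>\<open>M\<close> collects the constants left when \<open>norm (z - x)\<close>
      is bounded by \<open>norm (z - w) + norm (w - x)\<close>. In the radius below, the summand 1
      forces \<open>?r > 1\<close>, so that \<open>M \<le> M * ?r\<close>; the quotient forces
      \<open>\<bar>K\<bar> + M < c * ?r\<close>.\<close>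
    define M where "M = 1 + \<bar>K\<bar> * norm (w - x) + c * (norm (x - w))\<^sup>2"
    have "norm (z - w) \<le> (\<bar>K\<bar> + M) / c + 1" if "?\<phi> z \<le> ?\<phi> x" for z
    proof (rule ccontr)
      assume neg: "\<not> norm (z - w) \<le> (\<bar>K\<bar> + M) / c + 1"
      let ?r = "norm (z - w)"
      have "M \<ge> 0" using \<open>c > 0\<close> by (auto simp: M_def)
      then have "0 \<le> (\<bar>K\<bar> + M) / c" using \<open>c > 0\<close> by simp
      with neg have r: "?r > 1" and "(\<bar>K\<bar> + M) / c < ?r" by linarith+
      from this(2) have r2: "\<bar>K\<bar> + M < c * ?r"
        using \<open>c > 0\<close> by (simp add: pos_divide_less_eq mult.commute)
      have "ereal (a - 1 - K * norm (z - x) + c * ?r\<^sup>2) \<le> ?\<phi> z"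
        using add_right_mono[OF K[of z], of "ereal (c * ?r\<^sup>2)"] by simp
      also note that
      finally have "a - 1 - K * norm (z - x) + c * ?r\<^sup>2 \<le> a + c * (norm (x - w))\<^sup>2"
        by (simp add: a)
      moreover have "K * norm (z - x) \<le> \<bar>K\<bar> * (?r + norm (w - x))"
        using norm_triangle_ineq[of "z - w" "w - x"]
        by (intro mult_mono) auto
      ultimately have "c * ?r\<^sup>2 \<le> \<bar>K\<bar> * ?r + M"
        by (simp add: M_def algebra_simps)
      also have "\<dots> \<le> (\<bar>K\<bar> + M) * ?r"
        using r \<open>M \<ge> 0\<close> by (simp add: algebra_simps mult_le_cancel_left1)
      also have "\<dots> < c * ?r * ?r"
        using r r2 by (intro mult_strict_right_mono) auto
      finally show False by (simp add: power2_eq_square)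
    qed
    then show ?thesis
      by (intro bounded_subset[OF bounded_cball[of w "(\<bar>K\<bar> + M) / c + 1"]])
        (auto simp: dist_norm norm_minus_commute)
  qed
  ultimately show ?thesis
    by (rule lower_semicontinuous_attains_inf)
qed

text \<open>The definite description in \<open>prox\<close> needs existence and uniqueness first.
  Two minimizers \<open>p\<close> and \<open>q\<close> coincide: adding the variational inequality
  of each, tested at the other, leaves a nonnegative value equal to
  \<open>- (2 * c * ((q - p) \<bullet> (q - p)))\<close>.\<close>

lemma prox_inequality:
  fixes g :: "'a::euclidean_space \<Rightarrow> ereal"
  assumes proper: "proper_fun g" and cvx: "convex_ereal_fun g" and lsc: "lower_semicontinuous g"
    and "\<alpha> > 0"
  shows "\<bar>g (prox \<alpha> g w)\<bar> \<noteq> \<infinity>"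
    and "g z = ereal b \<Longrightarrow>
      real_of_ereal (g (prox \<alpha> g w)) - b \<le> 1 / \<alpha> * ((prox \<alpha> g w - w) \<bullet> (z - prox \<alpha> g w))"
proof -
  define c where "c = 1 / (2 * \<alpha>)"
  have c: "c > 0" "2 * c = 1 / \<alpha>" using \<open>\<alpha> > 0\<close> by (auto simp: c_def)
  define \<phi> where "\<phi> = (\<lambda>z. g z + ereal (c * (norm (z - w))\<^sup>2))"
  obtain x a where a: "g x = ereal a"
    using proper unfolding proper_fun_def by (metis ereal_cases)
  \<comment> \<open>Comparison with a point of the domain excludes the value \<infinity> at a
    minimizer; properness excludes -\<infinity>.\<close>
  have fin: "\<exists>r. g p = ereal r" if "\<And>z. \<phi> p \<le> \<phi> z" for p
    using that[of x] a proper by (cases "g p") (auto simp: \<phi>_def proper_fun_def)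
  have ineq: "r - s \<le> 2 * c * ((p - w) \<bullet> (q - p))"
    if "\<And>z. \<phi> p \<le> \<phi> z" "g p = ereal r" "g q = ereal s" for p q r s
    using prox_objective_minimizer_inequality[OF cvx c(1), of p w r q s] that by (simp add: \<phi>_def)
  obtain p where p: "\<And>z. \<phi> p \<le> \<phi> z"
    using prox_objective_has_minimizer[OF proper cvx lsc c(1), of w] by (auto simp: \<phi>_def)
  have uniq: "q = p" if q: "\<And>z. \<phi> q \<le> \<phi> z" for q
  proof -
    obtain r s where "g p = ereal r" "g q = ereal s" using fin p q by metis
    then have "r - s \<le> 2 * c * ((p - w) \<bullet> (q - p))" "s - r \<le> 2 * c * ((q - w) \<bullet> (p - q))"
      using ineq p q by blast+
    then have "0 \<le> 2 * c * ((p - w) \<bullet> (q - p)) + 2 * c * ((q - w) \<bullet> (p - q))"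
      by linarith
    also have "\<dots> = - (2 * c * ((q - p) \<bullet> (q - p)))"
      by (simp add: inner_diff_left inner_diff_right algebra_simps inner_commute)
    finally have "(q - p) \<bullet> (q - p) \<le> 0"
      using c(1) by (simp add: mult_le_0_iff)
    then have "(q - p) \<bullet> (q - p) = 0"
      by (intro antisym inner_ge_zero)
    then show ?thesis by simp
  qed
  have "prox \<alpha> g w = p"
    unfolding prox_def
    using p uniq by (intro the_equality) (auto simp: is_arg_min_linorder \<phi>_def c_def)
  moreover obtain r where "g p = ereal r" using fin p by blast
  ultimately show "\<bar>g (prox \<alpha> g w)\<bar> \<noteq> \<infinity>"
    and "g z = ereal b \<Longrightarrow>
      real_of_ereal (g (prox \<alpha> g w)) - b \<le> 1 / \<alpha> * ((prox \<alpha> g w - w) \<bullet> (z - prox \<alpha> g w))"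
    using ineq[OF p, of r z b] c(2) by auto
qed

section \<open>Tangent and quadratic bounds for the smooth term\<close>

lemma GDERIV_along_line:
  fixes f :: "'a::real_inner \<Rightarrow> real"
  assumes "\<And>y. GDERIV f y :> f' y"
  shows "((\<lambda>t. f (x + t *\<^sub>R d)) has_real_derivative f' (x + t *\<^sub>R d) \<bullet> d) (at t within T)"
proof -
  have "((\<lambda>t. x + t *\<^sub>R d) has_derivative (\<lambda>h. h *\<^sub>R d)) (at t within T)"
    by (auto intro!: derivative_eq_intros)
  from has_derivative_compose[OF this assms[unfolded gderiv_def]] show ?thesis
    by (simp add: has_field_derivative_def inner_commute mult_commute_abs)
qed

text \<open>Restriction to the line through \<open>x\<close> and \<open>y\<close> reduces this to
  the tangent inequality in one real variable.\<close>

lemma convex_on_above_tangent_gderiv: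
  fixes f :: "'a::real_inner \<Rightarrow> real"
  assumes "convex_on UNIV f" and deriv: "\<And>y. GDERIV f y :> f' y"
  shows "f x + f' x \<bullet> (y - x) \<le> f y"
proof -
  have "convex_on UNIV (\<lambda>t. f (x + t *\<^sub>R (y - x)))"
  proof (intro convex_onI)
    fix t a b :: real assume "0 < t" "t < 1"
    moreover have "x + ((1 - t) *\<^sub>R a + t *\<^sub>R b) *\<^sub>R (y - x)
        = (1 - t) *\<^sub>R (x + a *\<^sub>R (y - x)) + t *\<^sub>R (x + b *\<^sub>R (y - x))"
      by (simp add: algebra_simps)
    ultimately show "f (x + ((1 - t) *\<^sub>R a + t *\<^sub>R b) *\<^sub>R (y - x))
        \<le> (1 - t) * f (x + a *\<^sub>R (y - x)) + t * f (x + b *\<^sub>R (y - x))"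
      using convex_onD[OF assms(1), of t] by simp
  qed auto
  from convex_on_imp_above_tangent[OF this _ _ _ GDERIV_along_line[OF deriv], of 0 1]
  show ?thesis by simp
qed

text \<open>No integral of the gradient is taken: along the segment, \<open>f\<close> minus its
  linear and quadratic model is nonincreasing, since Cauchy-Schwarz and the Lipschitz bound make its
  derivative nonpositive.\<close>

lemma descent_lemma:
  fixes f :: "'a::real_inner \<Rightarrow> real"
  assumes deriv: "\<And>y. GDERIV f y :> f' y" and lip: "L-lipschitz_on UNIV f'"
  shows "f y \<le> f x + f' x \<bullet> (y - x) + L / 2 * (norm (y - x))\<^sup>2"
proof -
  define d where "d = y - x"
  let ?h = "\<lambda>t. f (x + t *\<^sub>R d) - t * (f' x \<bullet> d) - L / 2 * t\<^sup>2 * (norm d)\<^sup>2"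
  have "?h 1 \<le> ?h 0"
  proof (rule DERIV_nonpos_imp_nonincreasing[where f = ?h])
    fix t :: real assume t: "0 \<le> t" "t \<le> 1"
    let ?D = "f' (x + t *\<^sub>R d) \<bullet> d - f' x \<bullet> d - L * t * (norm d)\<^sup>2"
    have "(?h has_real_derivative ?D) (at t)"
      by (auto intro!: derivative_eq_intros GDERIV_along_line[OF deriv])
    moreover have "?D \<le> 0"
    proof -
      have "f' (x + t *\<^sub>R d) \<bullet> d - f' x \<bullet> d = (f' (x + t *\<^sub>R d) - f' x) \<bullet> d"
        by (simp add: inner_diff_left)
      also have "\<dots> \<le> norm (f' (x + t *\<^sub>R d) - f' x) * norm d"
        by (rule norm_cauchy_schwarz)
      also have "\<dots> \<le> L * norm (t *\<^sub>R d) * norm d"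
        using lipschitz_onD[OF lip, of "x + t *\<^sub>R d" x]
        by (intro mult_right_mono) (auto simp: dist_norm)
      also have "\<dots> = L * t * (norm d)\<^sup>2"
        using t by (simp add: power2_eq_square)
      finally show ?thesis by simp
    qed
    ultimately show "\<exists>y. (?h has_real_derivative y) (at t) \<and> y \<le> 0" by blast
  qed simp
  then show ?thesis by (simp add: d_def)
qed

section \<open>Self-contractedness of the proximal gradient iteration\<close>

lemma self_contractedI_step:
  assumes step: "\<And>k m. k < m \<Longrightarrow> norm (x m - x (Suc k)) \<le> norm (x m - x k)"
  shows "self_contracted x"
  unfolding self_contracted_def
proof (intro allI impI, elim conjE)
  fix k1 k2 k3 :: nat
  assume "k1 \<le> k2" "k2 \<le> k3"
  then show "norm (x k3 - x k2) \<le> norm (x k3 - x k1)"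
  \<comment> \<open>Downward induction on \<open>k1\<close>, starting from the trivial case
    \<open>k1 = k2\<close>; each step back is one use of the hypothesis with target
    \<open>k3\<close>.\<close>
  proof (induction rule: inc_induct)
    case (step n)
    then show ?case using assms[of n k3] by simp
  qed simp
qed

theorem theorem3p2:
  fixes g :: "real ^ 'd \<Rightarrow> ereal"
    and f :: "real ^ 'd \<Rightarrow> real"
    and grad_f :: "real ^ 'd \<Rightarrow> real ^ 'd"
    and L :: real
    and \<alpha> :: "nat \<Rightarrow> real"
    and x0 :: "real ^ 'd"
    and x :: "nat \<Rightarrow> real ^ 'd"
  assumes "proper_fun g" and "convex_ereal_fun g" and "lower_semicontinuous g"
    and "convex_on UNIV f"
    and "\<And>y. GDERIV f y :> grad_f y"
    and "L > 0" and "L-lipschitz_on UNIV grad_f"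
    and "range \<alpha> \<subseteq> {0<..<1 / L}"
    and "x 0 = x0"
    and "\<And>k. x (Suc k) = prox (\<alpha> k) g (x k - \<alpha> k *\<^sub>R grad_f (x k))"
  shows "self_contracted x"
proof (rule self_contractedI_step)
  \<comment> \<open>\<open>real_of_ereal\<close> sends infinite values to 0, so \<open>F z\<close>
    is the true objective only where \<open>g z\<close> is finite; hence the finiteness condition in
    \<open>key\<close>.\<close>
  define F where "F = (\<lambda>z. f z + real_of_ereal (g z))"
  have \<alpha>: "0 < \<alpha> k" "L < 1 / \<alpha> k" for k
  proof -
    have "0 < \<alpha> k" "\<alpha> k < 1 / L" using assms(8) by (auto simp: image_subset_iff)
    then show "0 < \<alpha> k" "L < 1 / \<alpha> k" using \<open>L > 0\<close> by (auto simp: field_simps)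
  qed
  have fin: "\<bar>g (x (Suc k))\<bar> \<noteq> \<infinity>" for k
    using prox_inequality(1)[OF assms(1-3) \<alpha>(1)] by (simp add: assms(10))
  have key: "2 * \<alpha> k * (F (x (Suc k)) - F z) \<le> (norm (z - x k))\<^sup>2 - (norm (z - x (Suc k)))\<^sup>2"
    if z: "\<bar>g z\<bar> \<noteq> \<infinity>" for k z
  proof -
    let ?p = "x (Suc k)" and ?x = "x k" and ?a = "\<alpha> k"
    have "real_of_ereal (g ?p) - real_of_ereal (g z)
        \<le> 1 / ?a * ((?p - (?x - ?a *\<^sub>R grad_f ?x)) \<bullet> (z - ?p))"
      using prox_inequality(2)[OF assms(1-3) \<alpha>(1), of z "real_of_ereal (g z)"] z
      by (simp add: assms(10) ereal_real)
    also have "\<dots> = 1 / ?a * ((?p - ?x) \<bullet> (z - ?p)) + grad_f ?x \<bullet> (z - ?p)"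
      using \<alpha>(1)[of k] by (simp add: inner_diff_left inner_add_left field_simps)
    finally have 1: "real_of_ereal (g ?p) - real_of_ereal (g z)
        \<le> 1 / ?a * ((?p - ?x) \<bullet> (z - ?p)) + grad_f ?x \<bullet> (z - ?p)" .
    have 2: "f ?x + grad_f ?x \<bullet> (z - ?x) \<le> f z"
      by (rule convex_on_above_tangent_gderiv[OF assms(4,5)])
    have 3: "f ?p \<le> f ?x + grad_f ?x \<bullet> (?p - ?x) + L / 2 * (norm (?p - ?x))\<^sup>2"
      by (rule descent_lemma[OF assms(5,7)])
    \<comment> \<open>The step-size bound enters here: the remainder of the descent lemma is
      absorbed by the quadratic with coefficient \<open>1 / (2 * ?a)\<close>.\<close>
    have 4: "L / 2 * (norm (?p - ?x))\<^sup>2 \<le> (1 / ?a) / 2 * (norm (?p - ?x))\<^sup>2"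
      using \<alpha>(2)[of k] by (intro mult_right_mono) auto
    have 5: "grad_f ?x \<bullet> (z - ?p) + grad_f ?x \<bullet> (?p - ?x) = grad_f ?x \<bullet> (z - ?x)"
      by (simp add: inner_diff_right)
    have "F ?p - F z \<le> 1 / ?a * ((?p - ?x) \<bullet> (z - ?p)) + (1 / ?a) / 2 * (norm (?p - ?x))\<^sup>2"
      using 1 2 3 4 5 unfolding F_def by linarith
    then have "2 * ?a * (F ?p - F z) \<le> 2 * ((?p - ?x) \<bullet> (z - ?p)) + (norm (?p - ?x))\<^sup>2"
      using \<alpha>(1)[of k] by (simp add: field_simps)
    \<comment> \<open>Expand the square of \<open>z - ?x = (z - ?p) + (?p - ?x)\<close>.\<close>
    also have "\<dots> = (norm (z - ?x))\<^sup>2 - (norm (z - ?p))\<^sup>2"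
      by (simp add: power2_norm_eq_inner inner_diff_left inner_diff_right inner_commute)
    finally show ?thesis .
  qed
  have "F (x (Suc (Suc k))) \<le> F (x (Suc k))" for k
  proof -
    \<comment> \<open>With \<open>z\<close> the current iterate, the first square is 0 and the
      right-hand side is minus a square.\<close>
    have "2 * \<alpha> (Suc k) * (F (x (Suc (Suc k))) - F (x (Suc k))) \<le> 0"
      by (rule order_trans[OF key[OF fin]]) simp
    then show ?thesis using \<alpha>(1)[of "Suc k"] by (simp add: mult_le_0_iff)
  qed
  then have "decseq (\<lambda>k. F (x (Suc k)))" by (rule decseq_SucI)
  then have mono: "F (x (Suc m)) \<le> F (x (Suc k))" if "k \<le> m" for k m
    using that by (rule decseqD)
  fix k m :: nat assume "k < m"
  \<comment> \<open>Writing \<open>m\<close> as a successor makes \<open>g (x m)\<close> finite and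
    matches the shifted indices in \<open>mono\<close>.\<close>
  then obtain n where n: "m = Suc n" "k \<le> n" by (cases m) auto
  have "0 \<le> 2 * \<alpha> k * (F (x (Suc k)) - F (x m))"
    using mono[OF n(2)] \<alpha>(1)[of k] n(1) by simp
  also have "\<dots> \<le> (norm (x m - x k))\<^sup>2 - (norm (x m - x (Suc k)))\<^sup>2"
    using key[OF fin] n(1) by simp
  finally show "norm (x m - x (Suc k)) \<le> norm (x m - x k)"
    using power2_le_imp_le[OF _ norm_ge_zero] by simp
qed

end
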